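(* If $\alpha\geq 2$ is an ordinal and $k$ is a positive integer, then \[R(\alpha,k+1)\geq P(\alpha)_k,\qquad R^{top}(\alpha,k+1)\ge P^{top}(\alpha)_k,\qquad R^{cl}(\alpha,k+1)\ge P^{cl}(\alpha)_k.\]
   Context: Every ordinal is identified with the set of smaller ordinals and carries the order topology; subsets carry the subspace topology. A set $X$ of ordinals is order-homeomorphic to an ordinal $\alpha$ if there is a bijection $X\to\alpha$ that is both an order-isomorphism and a homeomorphism; equivalently, $X$ is order-isomorphic to $\alpha$ and closed in its supremum. $[X]^2$ is the set of $2$-element subsets of $X$. $R(\alpha,k)$ (respectively $R^{top}(\alpha,k)$, $R^{cl}(\alpha,k)$) is the least ordinal $\beta$ such that for every coloring $c:[\beta]^2\to\{\text{red},\text{blue}\}$ either there is $X\subseteq\beta$ order-isomorphic (respectively homeomorphic, order-homeomorphic) to $\alpha$ with all elements of $[X]^2$ red, or there is a $k$-element $Y\subseteq\beta$ with all elements of $[Y]^2$ blue. $P(\alpha)_k$ (respectively $P^{top}(\alpha)_k$, $P^{cl}(\alpha)_k$) is the least ordinal $\beta$ such that for every coloring $c:\beta\to k$ with $k$ colors there are a color $i$ and $X\subseteq c^{-1}(\{i\})$ order-isomorphic (respectively homeomorphic, order-homeomorphic) to $\alpha$. If no ordinal as required exists, the corresponding number is regarded as $\infty$, larger than every ordinal. *)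

theory Defs
  imports "HOL-Analysis.Analysis" "HOL-Library.Ramsey" "HOL-Library.Extended"
begin

text \<open>
  There is no type of all ordinals. Ordinals are the elements of an arbitrary well-ordered type
  \<open>'o\<close>, an element \<open>\<alpha>\<close> being identified with the set \<open>{..<\<alpha>}\<close> of smaller elements, and the sort
  \<open>{wellorder, linorder_topology}\<close> says that \<open>'o\<close> carries its order topology. Every ordinal arises
  as an element of some such type. All notions below refer only to subsets of the sets \<open>{..<\<beta>}\<close>,
  so they do not depend on the type in which \<open>\<alpha>\<close> and \<open>\<beta>\<close> are taken, except that the least ordinal
  with a given property is \<open>\<infinity>\<close> when none of the ordinals of \<open>'o\<close> has that property.

  An initial segment \<open>{..<\<beta>}\<close> is order-convex, so its order topology is the topology it has as a
  subspace of \<open>'o\<close>; this is the content of the following lemma.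
\<close>

lemma top_of_set_initial_segment:
  fixes \<beta> :: "'o :: {wellorder, linorder_topology}"
  shows "top_of_set {..<\<beta>} =
    topology_generated_by (insert {..<\<beta>} ((\<lambda>a. {..<a}) ` {..<\<beta>} \<union> (\<lambda>a. {a<..<\<beta>}) ` {..<\<beta>}))"
    (is "_ = topology_generated_by ?B")
proof -
  have restrict: "generate_topology_on ?B (T \<inter> {..<\<beta>})"
    if "generate_topology (range lessThan \<union> range greaterThan) T" for T
    using that
  proof induction
    case UNIV
    show ?case by (auto intro: generate_topology_on.Basis)
  next
    case (Int U V)
    then have "generate_topology_on ?B ((U \<inter> {..<\<beta>}) \<inter> (V \<inter> {..<\<beta>}))"
      by (intro generate_topology_on.Int[of ?B "U \<inter> {..<\<beta>}" "V \<inter> {..<\<beta>}"])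
    moreover have "(U \<inter> {..<\<beta>}) \<inter> (V \<inter> {..<\<beta>}) = (U \<inter> V) \<inter> {..<\<beta>}" by auto
    ultimately show ?case by simp
  next
    case (UN K)
    have "generate_topology_on ?B (\<Union> ((\<lambda>U. U \<inter> {..<\<beta>}) ` K))"
      by (rule generate_topology_on.UN) (use UN.IH in auto)
    moreover have "\<Union> ((\<lambda>U. U \<inter> {..<\<beta>}) ` K) = \<Union> K \<inter> {..<\<beta>}" by auto
    ultimately show ?case by simp
  next
    case (Basis U)
    then consider a where "U = {..<a}" | a where "U = {a<..}" by auto
    then show ?case
    proof cases
      case 1
      then have "U \<inter> {..<\<beta>} = {..<min a \<beta>}" by auto
      moreover have "{..<min a \<beta>} \<in> ?B" by (cases "a < \<beta>") (auto simp: min_def)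
      ultimately show ?thesis by (simp add: generate_topology_on.Basis)
    next
      case 2
      then have eq: "U \<inter> {..<\<beta>} = {a<..<\<beta>}" by auto
      show ?thesis
      proof (cases "a < \<beta>")
        case True
        then show ?thesis by (auto simp: eq intro: generate_topology_on.Basis)
      next
        case False
        then have "{a<..<\<beta>} = {}" by auto
        then show ?thesis by (metis eq generate_topology_on.Empty)
      qed
    qed
  qed
  have basis: "openin (top_of_set {..<\<beta>}) U" if "U \<in> ?B" for U
    using that by (auto simp: intro!: open_openin_trans)
  have "openin (top_of_set {..<\<beta>}) S" if "generate_topology_on ?B S" for S
    using that by induction (auto intro: basis)
  moreover have "generate_topology_on ?B S" if "openin (top_of_set {..<\<beta>}) S" for S
  proof -
    from that obtain T where T: "open T" "S = {..<\<beta>} \<inter> T" by (auto simp: openin_open)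
    have "generate_topology (range lessThan \<union> range greaterThan) T"
      using T(1) unfolding open_generated_order by simp
    from restrict[OF this] show ?thesis by (simp add: T(2) Int_commute)
  qed
  ultimately show ?thesis
    by (auto simp: topology_eq openin_topology_generated_by_iff)
qed

definition order_isomorphic :: "'o::wellorder set \<Rightarrow> 'o \<Rightarrow> bool" where
  "order_isomorphic X \<alpha> \<longleftrightarrow>
     (\<exists>f. bij_betw f X {..<\<alpha>} \<and> (\<forall>x\<in>X. \<forall>y\<in>X. x \<le> y \<longleftrightarrow> f x \<le> f y))"

definition ord_homeomorphic :: "'o::{wellorder, linorder_topology} set \<Rightarrow> 'o \<Rightarrow> bool" where
  "ord_homeomorphic X \<alpha> \<longleftrightarrow> X homeomorphic {..<\<alpha>}"

definition order_homeomorphic :: "'o::{wellorder, linorder_topology} set \<Rightarrow> 'o \<Rightarrow> bool" where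
  "order_homeomorphic X \<alpha> \<longleftrightarrow>
     (\<exists>f g. homeomorphism X {..<\<alpha>} f g \<and> (\<forall>x\<in>X. \<forall>y\<in>X. x \<le> y \<longleftrightarrow> f x \<le> f y))"

definition least_ordinal :: "('o::wellorder \<Rightarrow> bool) \<Rightarrow> 'o extended" where
  "least_ordinal Q = (if \<exists>\<beta>. Q \<beta> then Fin (LEAST \<beta>. Q \<beta>) else Pinf)"

datatype colour = Red | Blue

text \<open>
  The three variants differ only in the relation \<open>copy X \<alpha>\<close> saying that \<open>X\<close> is a copy of \<open>\<alpha>\<close>.
  A colouring is a total function whose values outside \<open>[\<beta>]\<^bsup>2\<^esup>\<close>, respectively outside \<open>{..<\<beta>}\<close>,
  are irrelevant.
\<close>

definition ramsey_number ::
    "('o::wellorder set \<Rightarrow> 'o \<Rightarrow> bool) \<Rightarrow> 'o \<Rightarrow> nat \<Rightarrow> 'o extended" where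
  "ramsey_number copy \<alpha> k = least_ordinal (\<lambda>\<beta>. \<forall>c :: 'o set \<Rightarrow> colour.
     (\<exists>X \<subseteq> {..<\<beta>}. copy X \<alpha> \<and> (\<forall>e \<in> [X]\<^bsup>2\<^esup>. c e = Red)) \<or>
     (\<exists>Y \<in> [{..<\<beta>}]\<^bsup>k\<^esup>. \<forall>e \<in> [Y]\<^bsup>2\<^esup>. c e = Blue))"

definition pigeonhole_number ::
    "('o::wellorder set \<Rightarrow> 'o \<Rightarrow> bool) \<Rightarrow> 'o \<Rightarrow> nat \<Rightarrow> 'o extended" where
  "pigeonhole_number copy \<alpha> k = least_ordinal (\<lambda>\<beta>. \<forall>c \<in> {..<\<beta>} \<rightarrow> {..<k}.
     \<exists>i<k. \<exists>X \<subseteq> {x \<in> {..<\<beta>}. c x = i}. copy X \<alpha>)"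

definition "R_ord \<alpha> k = ramsey_number order_isomorphic \<alpha> k"
definition "R_top \<alpha> k = ramsey_number ord_homeomorphic \<alpha> k"
definition "R_cl \<alpha> k = ramsey_number order_homeomorphic \<alpha> k"

definition "P_ord \<alpha> k = pigeonhole_number order_isomorphic \<alpha> k"
definition "P_top \<alpha> k = pigeonhole_number ord_homeomorphic \<alpha> k"
definition "P_cl \<alpha> k = pigeonhole_number order_homeomorphic \<alpha> k"

end

theory Submission
  imports Defs
begin

text \<open>
  A colouring \<open>c\<close> of the points of \<open>\<beta>\<close> with \<open>k\<close> colours induces a colouring of pairs: a pair is
  red if \<open>c\<close> is constant on it and blue otherwise. On a set all of whose pairs are blue, \<open>c\<close> is
  injective, so such a set has at most \<open>k\<close> elements. A set all of whose pairs are red is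
  monochromatic for \<open>c\<close>. Hence every \<open>\<beta>\<close> with the Ramsey property for \<open>\<alpha>\<close> and \<open>k + 1\<close> has the
  pigeonhole property for \<open>\<alpha>\<close> and \<open>k\<close>. The copy of \<open>\<alpha>\<close> is the same set in both, so one
  argument, for an arbitrary relation \<open>copy\<close>, gives all three inequalities.
\<close>

lemma least_ordinal_antimono:
  assumes "\<And>\<beta>. Q \<beta> \<Longrightarrow> P \<beta>"
  shows "least_ordinal P \<le> least_ordinal Q"
  using assms unfolding least_ordinal_def by (auto intro: Least_le LeastI2_ex)

definition same_colour :: "('a \<Rightarrow> nat) \<Rightarrow> 'a set \<Rightarrow> colour" where
  "same_colour c e = (if \<exists>i. \<forall>x\<in>e. c x = i then Red else Blue)"

lemma same_colour_doubleton: "same_colour c {x, y} = Red \<longleftrightarrow> c x = c y"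
  by (auto simp: same_colour_def)

lemma doubleton_in_nsets_2: "x \<in> A \<Longrightarrow> y \<in> A \<Longrightarrow> x \<noteq> y \<Longrightarrow> {x, y} \<in> [A]\<^bsup>2\<^esup>"
  by (auto simp: nsets_def)

lemma all_pairs_red_imp_monochromatic:
  assumes "\<forall>e \<in> [X]\<^bsup>2\<^esup>. same_colour c e = Red" and "x \<in> X" "y \<in> X"
  shows "c x = c y"
  using assms by (metis doubleton_in_nsets_2 same_colour_doubleton)

lemma all_pairs_blue_imp_inj_on:
  assumes "\<forall>e \<in> [Y]\<^bsup>2\<^esup>. same_colour c e = Blue"
  shows "inj_on c Y"
  using assms by (metis colour.distinct(1) doubleton_in_nsets_2 inj_onI same_colour_doubleton)

text \<open>
  For a point colouring \<open>c\<close>, the Ramsey property is applied to \<open>same_colour c\<close>. Its blue alternative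
  would inject \<open>k + 1\<close> points into \<open>k\<close> colours, and its red alternative is the required copy.
\<close>

lemma pigeonhole_number_le_ramsey_number:
  fixes copy :: "'o::wellorder set \<Rightarrow> 'o \<Rightarrow> bool"
  assumes "0 < k"
  shows "pigeonhole_number copy \<alpha> k \<le> ramsey_number copy \<alpha> (k + 1)"
  unfolding pigeonhole_number_def ramsey_number_def
proof (rule least_ordinal_antimono, rule ballI)
  fix \<beta> :: 'o and c :: "'o \<Rightarrow> nat"
  assume ramsey: "\<forall>c :: 'o set \<Rightarrow> colour.
     (\<exists>X \<subseteq> {..<\<beta>}. copy X \<alpha> \<and> (\<forall>e \<in> [X]\<^bsup>2\<^esup>. c e = Red)) \<or>
     (\<exists>Y \<in> [{..<\<beta>}]\<^bsup>(k + 1)\<^esup>. \<forall>e \<in> [Y]\<^bsup>2\<^esup>. c e = Blue)"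
    and c: "c \<in> {..<\<beta>} \<rightarrow> {..<k}"
  have no_blue: "\<not> (\<forall>e \<in> [Y]\<^bsup>2\<^esup>. same_colour c e = Blue)" if "Y \<in> [{..<\<beta>}]\<^bsup>(k + 1)\<^esup>" for Y
  proof
    assume "\<forall>e \<in> [Y]\<^bsup>2\<^esup>. same_colour c e = Blue"
    then have "inj_on c Y" by (rule all_pairs_blue_imp_inj_on)
    moreover have "c ` Y \<subseteq> {..<k}" and "card Y = k + 1"
      using that c by (auto simp: nsets_def)
    ultimately show False
      using card_inj_on_le[of c Y "{..<k}"] by simp
  qed
  from ramsey no_blue obtain X where X: "X \<subseteq> {..<\<beta>}" "copy X \<alpha>"
      and red: "\<forall>e \<in> [X]\<^bsup>2\<^esup>. same_colour c e = Red"
    by blast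
  have "\<exists>i<k. \<forall>x\<in>X. c x = i"
  proof (cases "X = {}")
    case True
    (* Every colour contains the empty set, and there is a colour because 0 < k. *)
    then show ?thesis using assms by auto
  next
    case False
    then obtain x where x: "x \<in> X" by blast
    then have "c x < k" using X(1) c by auto
    moreover have "\<forall>y\<in>X. c y = c x"
      using all_pairs_red_imp_monochromatic[OF red] x by blast
    ultimately show ?thesis by blast
  qed
  then show "\<exists>i<k. \<exists>X \<subseteq> {x \<in> {..<\<beta>}. c x = i}. copy X \<alpha>"
    using X by blast
qed

theorem proposition3p1:
  fixes \<alpha> :: "'o :: {wellorder, linorder_topology}" and k :: nat
  assumes "\<exists>\<zeta> \<xi>. \<zeta> < \<xi> \<and> \<xi> < \<alpha>"  (* \<alpha> \<ge> 2 *)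
    and "0 < k"
  shows "R_ord \<alpha> (k + 1) \<ge> P_ord \<alpha> k \<and>
         R_top \<alpha> (k + 1) \<ge> P_top \<alpha> k \<and>
         R_cl \<alpha> (k + 1) \<ge> P_cl \<alpha> k"
  unfolding R_ord_def R_top_def R_cl_def P_ord_def P_top_def P_cl_def
  using pigeonhole_number_le_ramsey_number[OF assms(2)] by blast

end
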